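(* Let $(A,\to,\rightsquigarrow,0,1)$ be a bounded commutative pseudo BE-algebra and let $\tau:A\to A$ be a map satisfying, for all $x,y\in A$: (U1) $\tau x\le x$; (U2) $(\tau (x^{-}))^{\sim}=(\tau (x^{\sim}))^{-}$; (U3) $\tau(x\oplus(\tau y)^{-})=\tau x\oplus(\tau y)^{-}$ and $\tau((\tau x)^{\sim}\oplus y)=(\tau x)^{\sim}\oplus\tau y$; (U4) $\tau(x\oplus\tau y)=\tau(\tau x\oplus y)=\tau x\oplus\tau y$; (U5) $\tau((x^{-}\oplus x^{-})^{\sim})=((\tau x)^{-}\oplus(\tau x)^{-})^{\sim}$ and $\tau((x^{\sim}\oplus x^{\sim})^{-})=((\tau x)^{\sim}\oplus(\tau x)^{\sim})^{-}$; (U6) $\tau(x\oplus x)=\tau x\oplus\tau x$. Then $\forall:=\tau$ is a universal quantifier on the corresponding pseudo MV-algebra $(A,\odot,\oplus,{}^{-},{}^{\sim},0,1)$; that is, for all $x,y\in A$: $\forall x\le x$; $\forall(x\wedge y)=\forall x\wedge\forall y$; $\forall((\forall x)^{-})=(\forall x)^{-}$ and $\forall((\forall x)^{\sim})=(\forall x)^{\sim}$; $\forall(\forall x\odot\forall y)=\forall x\odot\forall y$; $\forall(x\odot x)=\forall x\odot\forall x$; $\forall(x\oplus x)=\forall x\oplus\forall x$.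
   Context: A pseudo BE-algebra is an algebra $(A,\to,\rightsquigarrow,1)$ of type $(2,2,0)$ such that for all $x,y,z\in A$: $x\to x=x\rightsquigarrow x=1$; $x\to 1=x\rightsquigarrow 1=1$; $1\to x=1\rightsquigarrow x=x$; $x\to(y\rightsquigarrow z)=y\rightsquigarrow(x\to z)$; and $x\to y=1$ iff $x\rightsquigarrow y=1$. One writes $x\le y$ iff $x\to y=1$ (equivalently $x\rightsquigarrow y=1$). It is commutative if $(x\to y)\rightsquigarrow y=(y\to x)\rightsquigarrow x$ and $(x\rightsquigarrow y)\to y=(y\rightsquigarrow x)\to x$ for all $x,y$. It is bounded if it has an element $0$ with $0\le x$ for all $x$; then $x^{-}=x\to 0$ and $x^{\sim}=x\rightsquigarrow 0$. In a bounded commutative pseudo BE-algebra, $x^{-\sim}=x^{\sim-}=x$ and $(A,\le)$ is a lattice with $x\vee y=(x\to y)\rightsquigarrow y=(x\rightsquigarrow y)\to y$ and $x\wedge y=(x^{-}\vee y^{-})^{\sim}=(x^{\sim}\vee y^{\sim})^{-}$. One sets $x\oplus y=y^{\sim}\to x=x^{-}\rightsquigarrow y$ and $x\odot y=(x\to y^{-})^{\sim}=(y\rightsquigarrow x^{\sim})^{-}$. The corresponding pseudo MV-algebra of $A$ is $(A,\odot,\oplus,{}^{-},{}^{\sim},0,1)$ with these operations, with the lattice order $\le$ above. *)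

theory Defs
  imports Main
begin

class pseudo_BE = one +
  fixes imp_l :: "'a \<Rightarrow> 'a \<Rightarrow> 'a" (infixr "\<rightarrow>" 60)
    and imp_r :: "'a \<Rightarrow> 'a \<Rightarrow> 'a" (infixr "\<leadsto>" 60)
  assumes imp_l_refl: "x \<rightarrow> x = 1"
    and imp_r_refl: "x \<leadsto> x = 1"
    and imp_l_one: "x \<rightarrow> 1 = 1"
    and imp_r_one: "x \<leadsto> 1 = 1"
    and one_imp_l: "1 \<rightarrow> x = x"
    and one_imp_r: "1 \<leadsto> x = x"
    and imp_exchange: "x \<rightarrow> (y \<leadsto> z) = y \<leadsto> (x \<rightarrow> z)"
    and imp_l_iff_imp_r: "x \<rightarrow> y = 1 \<longleftrightarrow> x \<leadsto> y = 1"
begin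

definition BE_le :: "'a \<Rightarrow> 'a \<Rightarrow> bool" (infix "\<sqsubseteq>" 50)
  where "x \<sqsubseteq> y \<longleftrightarrow> x \<rightarrow> y = 1"

end

class commutative_pseudo_BE = pseudo_BE +
  assumes commutative_l: "(x \<rightarrow> y) \<leadsto> y = (y \<rightarrow> x) \<leadsto> x"
    and commutative_r: "(x \<leadsto> y) \<rightarrow> y = (y \<leadsto> x) \<rightarrow> x"
begin

definition BE_join :: "'a \<Rightarrow> 'a \<Rightarrow> 'a" (infixl "\<squnion>" 65)
  where "x \<squnion> y = (x \<rightarrow> y) \<leadsto> y"

end

class bounded_pseudo_BE = pseudo_BE + zero +
  assumes zero_le: "0 \<sqsubseteq> x"
begin

definition neg_l :: "'a \<Rightarrow> 'a" ("_\<^sup>-" [1000] 999)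
  where "x\<^sup>- = x \<rightarrow> 0"

definition neg_r :: "'a \<Rightarrow> 'a" ("_\<^sup>\<sim>" [1000] 999)
  where "x\<^sup>\<sim> = x \<leadsto> 0"

definition BE_oplus :: "'a \<Rightarrow> 'a \<Rightarrow> 'a" (infixl "\<oplus>" 65)
  where "x \<oplus> y = y\<^sup>\<sim> \<rightarrow> x"

definition BE_odot :: "'a \<Rightarrow> 'a \<Rightarrow> 'a" (infixl "\<odot>" 70)
  where "x \<odot> y = (x \<rightarrow> y\<^sup>-)\<^sup>\<sim>"

end

class bounded_commutative_pseudo_BE = bounded_pseudo_BE + commutative_pseudo_BE
begin

definition BE_meet :: "'a \<Rightarrow> 'a \<Rightarrow> 'a" (infixl "\<sqinter>" 70)
  where "x \<sqinter> y = (x\<^sup>- \<squnion> y\<^sup>-)\<^sup>\<sim>"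

end

text \<open>
  The order and the operations are parameters, to be instantiated with those of the
  pseudo MV-algebra on which the quantifier acts. The axioms of pseudo MV-algebras are
  not assumed here.
\<close>
locale universal_quantifier =
  fixes le :: "'a \<Rightarrow> 'a \<Rightarrow> bool"
    and meet odot oplus :: "'a \<Rightarrow> 'a \<Rightarrow> 'a"
    and nl nr :: "'a \<Rightarrow> 'a"
    and Q :: "'a \<Rightarrow> 'a"
  assumes Q_le: "le (Q x) x"
    and Q_meet: "Q (meet x y) = meet (Q x) (Q y)"
    and Q_neg_l: "Q (nl (Q x)) = nl (Q x)"
    and Q_neg_r: "Q (nr (Q x)) = nr (Q x)"
    and Q_odot_Q: "Q (odot (Q x) (Q y)) = odot (Q x) (Q y)"
    and Q_odot_self: "Q (odot x x) = odot (Q x) (Q x)"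
    and Q_oplus_self: "Q (oplus x x) = oplus (Q x) (Q x)"

text \<open>
  The remaining lemmas confirm that the operations above are those of the lattice reduct and
  that the two expressions commonly given for each of them agree.
\<close>

context pseudo_BE
begin

lemma BE_le_refl: "x \<sqsubseteq> x"
  by (simp add: BE_le_def imp_l_refl)

lemma BE_le_iff_imp_r: "x \<sqsubseteq> y \<longleftrightarrow> x \<leadsto> y = 1"
  by (simp add: BE_le_def imp_l_iff_imp_r)

lemma BE_le_imp_r: "x \<sqsubseteq> y \<leadsto> x"
  by (simp add: BE_le_def imp_exchange imp_l_refl imp_r_one)

lemma BE_le_imp_l: "x \<sqsubseteq> y \<rightarrow> x"
  by (metis BE_le_iff_imp_r imp_exchange imp_r_refl imp_l_one)

end

context commutative_pseudo_BE
begin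

lemma BE_le_antisym: "x \<sqsubseteq> y \<Longrightarrow> y \<sqsubseteq> x \<Longrightarrow> x = y"
  by (metis BE_le_def commutative_l one_imp_r)

lemma join_eq_r_if_le: "y \<sqsubseteq> z \<Longrightarrow> (z \<rightarrow> y) \<leadsto> y = z"
  by (metis BE_le_def commutative_l one_imp_r)

lemma join_eq_l_if_le: "y \<sqsubseteq> z \<Longrightarrow> (z \<leadsto> y) \<rightarrow> y = z"
  by (metis BE_le_iff_imp_r commutative_r one_imp_l)

lemma BE_le_trans: "x \<sqsubseteq> y \<Longrightarrow> y \<sqsubseteq> z \<Longrightarrow> x \<sqsubseteq> z"
  by (metis BE_le_def join_eq_r_if_le imp_exchange imp_r_one)

lemma BE_join_upper1: "x \<sqsubseteq> x \<squnion> y"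
  by (simp add: BE_le_def BE_join_def imp_exchange imp_r_refl)

lemma BE_join_upper2: "y \<sqsubseteq> x \<squnion> y"
  by (simp add: BE_join_def BE_le_imp_r)

lemma join_r_upper1: "x \<sqsubseteq> (x \<leadsto> y) \<rightarrow> y"
  by (metis BE_le_iff_imp_r imp_exchange imp_l_refl)

lemma imp_l_antimono: "x \<sqsubseteq> y \<Longrightarrow> y \<rightarrow> z \<sqsubseteq> x \<rightarrow> z"
  by (metis BE_le_def BE_le_iff_imp_r BE_join_def BE_join_upper1 BE_le_trans imp_exchange)

lemma imp_r_antimono: "x \<sqsubseteq> y \<Longrightarrow> y \<leadsto> z \<sqsubseteq> x \<leadsto> z"
  by (metis BE_le_def BE_le_iff_imp_r join_r_upper1 BE_le_trans imp_exchange)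

lemma BE_join_least: "x \<sqsubseteq> z \<Longrightarrow> y \<sqsubseteq> z \<Longrightarrow> x \<squnion> y \<sqsubseteq> z"
  by (metis BE_join_def join_eq_r_if_le imp_l_antimono imp_r_antimono)

lemma BE_join_alt: "x \<squnion> y = (x \<leadsto> y) \<rightarrow> y"
proof (rule BE_le_antisym)
  show "x \<squnion> y \<sqsubseteq> (x \<leadsto> y) \<rightarrow> y"
    by (simp add: BE_join_least join_r_upper1 BE_le_imp_l)
  show "(x \<leadsto> y) \<rightarrow> y \<sqsubseteq> x \<squnion> y"
    by (metis BE_join_upper1 BE_join_upper2 join_eq_l_if_le imp_l_antimono imp_r_antimono)
qed

end

context bounded_commutative_pseudo_BE
begin

lemma neg_l_neg_r: "(x\<^sup>-)\<^sup>\<sim> = x"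
  by (simp add: neg_l_def neg_r_def join_eq_r_if_le zero_le)

lemma neg_r_neg_l: "(x\<^sup>\<sim>)\<^sup>- = x"
  by (simp add: neg_l_def neg_r_def join_eq_l_if_le zero_le)

lemma neg_l_le_iff: "x\<^sup>- \<sqsubseteq> y\<^sup>- \<longleftrightarrow> y \<sqsubseteq> x"
  by (metis imp_l_antimono imp_r_antimono neg_l_def neg_r_def neg_l_neg_r)

lemma neg_r_le_iff: "x\<^sup>\<sim> \<sqsubseteq> y\<^sup>\<sim> \<longleftrightarrow> y \<sqsubseteq> x"
  by (metis neg_l_le_iff neg_r_neg_l)

lemma BE_oplus_alt: "x \<oplus> y = x\<^sup>- \<leadsto> y"
  by (metis BE_oplus_def imp_exchange neg_l_def neg_r_def neg_l_neg_r neg_r_neg_l)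

lemma BE_odot_le_iff: "x \<odot> y \<sqsubseteq> z \<longleftrightarrow> x \<sqsubseteq> y \<rightarrow> z"
proof -
  have "x \<odot> y \<sqsubseteq> z \<longleftrightarrow> z\<^sup>- \<sqsubseteq> x \<rightarrow> y\<^sup>-"
    by (metis BE_odot_def neg_r_le_iff neg_l_neg_r)
  also have "\<dots> \<longleftrightarrow> x \<sqsubseteq> z\<^sup>- \<leadsto> y\<^sup>-"
    by (metis BE_le_def BE_le_iff_imp_r imp_exchange)
  also have "z\<^sup>- \<leadsto> y\<^sup>- = y \<rightarrow> z"
    by (metis imp_exchange neg_l_def neg_r_def neg_l_neg_r)
  finally show ?thesis .
qed

lemma odot_r_le_iff: "(y \<leadsto> x\<^sup>\<sim>)\<^sup>- \<sqsubseteq> z \<longleftrightarrow> y \<sqsubseteq> x \<leadsto> z"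
proof -
  have "(y \<leadsto> x\<^sup>\<sim>)\<^sup>- \<sqsubseteq> z \<longleftrightarrow> z\<^sup>\<sim> \<sqsubseteq> y \<leadsto> x\<^sup>\<sim>"
    by (metis neg_l_le_iff neg_r_neg_l)
  also have "\<dots> \<longleftrightarrow> y \<sqsubseteq> z\<^sup>\<sim> \<rightarrow> x\<^sup>\<sim>"
    by (metis BE_le_def BE_le_iff_imp_r imp_exchange)
  also have "z\<^sup>\<sim> \<rightarrow> x\<^sup>\<sim> = x \<leadsto> z"
    by (metis imp_exchange neg_l_def neg_r_def neg_r_neg_l)
  finally show ?thesis .
qed

lemma BE_odot_alt: "x \<odot> y = (y \<leadsto> x\<^sup>\<sim>)\<^sup>-"
proof -
  have "x \<odot> y \<sqsubseteq> z \<longleftrightarrow> (y \<leadsto> x\<^sup>\<sim>)\<^sup>- \<sqsubseteq> z" for z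
    unfolding BE_odot_le_iff odot_r_le_iff by (metis BE_le_def BE_le_iff_imp_r imp_exchange)
  then show ?thesis
    by (metis BE_le_antisym BE_le_refl)
qed

lemma BE_meet_lower1: "x \<sqinter> y \<sqsubseteq> x"
  by (metis BE_meet_def BE_join_upper1 neg_r_le_iff neg_l_neg_r)

lemma BE_meet_lower2: "x \<sqinter> y \<sqsubseteq> y"
  by (metis BE_meet_def BE_join_upper2 neg_r_le_iff neg_l_neg_r)

lemma BE_meet_greatest: "z \<sqsubseteq> x \<Longrightarrow> z \<sqsubseteq> y \<Longrightarrow> z \<sqsubseteq> x \<sqinter> y"
  by (metis BE_meet_def BE_join_least neg_l_le_iff neg_r_neg_l)

lemma BE_meet_alt: "x \<sqinter> y = (x\<^sup>\<sim> \<squnion> y\<^sup>\<sim>)\<^sup>-"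
proof (rule BE_le_antisym)
  show "x \<sqinter> y \<sqsubseteq> (x\<^sup>\<sim> \<squnion> y\<^sup>\<sim>)\<^sup>-"
    by (metis BE_join_least BE_meet_lower1 BE_meet_lower2 neg_l_neg_r neg_l_le_iff neg_r_le_iff)
  show "(x\<^sup>\<sim> \<squnion> y\<^sup>\<sim>)\<^sup>- \<sqsubseteq> x \<sqinter> y"
    by (metis BE_meet_greatest BE_join_upper1 BE_join_upper2 neg_r_neg_l neg_l_le_iff)
qed

lemma lattice_BE: "class.lattice (\<sqinter>) (\<sqsubseteq>) (\<lambda>x y. x \<sqsubseteq> y \<and> \<not> y \<sqsubseteq> x) (\<squnion>)"
  by unfold_locales
    (auto intro: BE_le_trans BE_le_antisym BE_meet_lower1 BE_meet_lower2 BE_meet_greatest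
      BE_join_upper1 BE_join_upper2 BE_join_least BE_le_refl)

end

end

theory Submission
  imports Defs
begin

text \<open>
  The map \<open>\<tau>\<close> is determined by its fixed points: they form a subalgebra, and \<open>\<tau> x\<close> is the largest
  fixed point below \<open>x\<close>; every required identity other than those for \<open>x \<oplus> x\<close> and \<open>x \<odot> x\<close> follows
  from this. The element \<open>0\<close> is fixed by U1. Putting \<open>0\<close> for one argument in U3 and U4 shows that
  \<open>\<tau> x\<close>, \<open>(\<tau> x)\<^sup>-\<close> and \<open>(\<tau> x)\<^sup>\<sim>\<close> are fixed, and U4 shows that sums of fixed points are fixed. All
  other operations are built from \<open>\<oplus>\<close> and the two negations, hence preserve fixed points.

  For maximality, let \<open>a\<close> be a fixed point with \<open>a \<sqsubseteq> y\<close>. The inequality says that the sum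
  \<open>a \<leadsto> y = a\<^sup>\<sim> \<oplus> y\<close> is \<open>1\<close>, and U3 moves \<open>\<tau>\<close> past the summand \<open>a\<^sup>\<sim>\<close>, so
  \<open>a \<leadsto> \<tau> y = \<tau> 1 = 1\<close>, that is, \<open>a \<sqsubseteq> \<tau> y\<close>. Monotonicity follows, and then preservation of meets:
  the meet \<open>\<tau> x \<sqinter> \<tau> y\<close> is a fixed point below \<open>x \<sqinter> y\<close>. Finally, the identities for \<open>x \<oplus> x\<close> and
  \<open>x \<odot> x\<close> are U6 and, since \<open>x \<odot> x = (x\<^sup>- \<oplus> x\<^sup>-)\<^sup>\<sim>\<close>, U5.
\<close>

context bounded_commutative_pseudo_BE
begin

lemma neg_r_zero: "0\<^sup>\<sim> = 1"
  by (simp add: neg_r_def imp_r_refl)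

lemma zero_oplus: "0 \<oplus> x = x"
  using neg_r_neg_l by (simp add: BE_oplus_def neg_l_def)

lemma oplus_zero: "x \<oplus> 0 = x"
  by (simp add: BE_oplus_def neg_r_zero one_imp_l)

lemma imp_l_eq_oplus: "x \<rightarrow> y = y \<oplus> x\<^sup>-"
  by (simp add: BE_oplus_def neg_l_neg_r)

lemma imp_r_eq_oplus: "x \<leadsto> y = x\<^sup>\<sim> \<oplus> y"
  by (simp add: BE_oplus_alt neg_r_neg_l)

lemma odot_eq_oplus: "x \<odot> y = (y\<^sup>- \<oplus> x\<^sup>-)\<^sup>\<sim>"
  by (simp add: BE_odot_def imp_l_eq_oplus)

lemma le_zero_iff: "x \<sqsubseteq> 0 \<longleftrightarrow> x = 0"
  using BE_le_antisym BE_le_refl zero_le by blast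

text \<open>The join is \<open>(x \<rightarrow> y) \<leadsto> y\<close> and both implications are sums, so \<open>\<oplus>\<close> and the negations generate
  the meet.\<close>

lemma meet_closed:
  assumes "\<And>x y. x \<in> F \<Longrightarrow> y \<in> F \<Longrightarrow> x \<oplus> y \<in> F"
    and "\<And>x. x \<in> F \<Longrightarrow> x\<^sup>- \<in> F" and "\<And>x. x \<in> F \<Longrightarrow> x\<^sup>\<sim> \<in> F"
    and "x \<in> F" and "y \<in> F"
  shows "x \<sqinter> y \<in> F"
  by (simp add: BE_meet_def BE_join_def imp_l_eq_oplus imp_r_eq_oplus assms)

end

theorem proposition5p17:
  fixes \<tau> :: "'a::bounded_commutative_pseudo_BE \<Rightarrow> 'a"
  assumes U1: "\<And>x. \<tau> x \<sqsubseteq> x"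
    and U2: "\<And>x. (\<tau> (x\<^sup>-))\<^sup>\<sim> = (\<tau> (x\<^sup>\<sim>))\<^sup>-"
    and U3_l: "\<And>x y. \<tau> (x \<oplus> (\<tau> y)\<^sup>-) = \<tau> x \<oplus> (\<tau> y)\<^sup>-"
    and U3_r: "\<And>x y. \<tau> ((\<tau> x)\<^sup>\<sim> \<oplus> y) = (\<tau> x)\<^sup>\<sim> \<oplus> \<tau> y"
    and U4_l: "\<And>x y. \<tau> (x \<oplus> \<tau> y) = \<tau> (\<tau> x \<oplus> y)"
    and U4_r: "\<And>x y. \<tau> (\<tau> x \<oplus> y) = \<tau> x \<oplus> \<tau> y"
    and U5_l: "\<And>x. \<tau> ((x\<^sup>- \<oplus> x\<^sup>-)\<^sup>\<sim>) = ((\<tau> x)\<^sup>- \<oplus> (\<tau> x)\<^sup>-)\<^sup>\<sim>"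
    and U5_r: "\<And>x. \<tau> ((x\<^sup>\<sim> \<oplus> x\<^sup>\<sim>)\<^sup>-) = ((\<tau> x)\<^sup>\<sim> \<oplus> (\<tau> x)\<^sup>\<sim>)\<^sup>-"
    and U6: "\<And>x. \<tau> (x \<oplus> x) = \<tau> x \<oplus> \<tau> x"
  shows "universal_quantifier (\<sqsubseteq>) (\<sqinter>) (\<odot>) (\<oplus>) neg_l neg_r \<tau>"
proof -
  define F where "F = {a. \<tau> a = a}"
  have zero: "\<tau> 0 = 0"
    using U1 le_zero_iff by blast
  have idem: "\<tau> (\<tau> x) = \<tau> x" for x
    using U4_r[of x 0] by (simp add: zero oplus_zero)
  have neg_l: "\<tau> ((\<tau> x)\<^sup>-) = (\<tau> x)\<^sup>-" for x
    using U3_l[of 0 x] by (simp add: zero zero_oplus)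
  have neg_r: "\<tau> ((\<tau> x)\<^sup>\<sim>) = (\<tau> x)\<^sup>\<sim>" for x
    using U3_r[of x 0] by (simp add: zero oplus_zero)
  have one: "\<tau> 1 = 1"
    using neg_r[of 0] by (simp add: zero neg_r_zero)
  have F_tau: "\<tau> x \<in> F" for x
    by (simp add: F_def idem)
  have F_oplus: "x \<oplus> y \<in> F" if "x \<in> F" "y \<in> F" for x y
    using U4_r[of x y] that by (simp add: F_def)
  have F_neg_l: "x\<^sup>- \<in> F" if "x \<in> F" for x
    using neg_l[of x] that by (simp add: F_def)
  have F_neg_r: "x\<^sup>\<sim> \<in> F" if "x \<in> F" for x
    using neg_r[of x] that by (simp add: F_def)
  have F_odot: "x \<odot> y \<in> F" if "x \<in> F" "y \<in> F" for x y
    unfolding odot_eq_oplus using that by (intro F_neg_r F_oplus F_neg_l)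
  have F_meet: "x \<sqinter> y \<in> F" if "x \<in> F" "y \<in> F" for x y
    using meet_closed F_oplus F_neg_l F_neg_r that by blast
  have greatest: "a \<sqsubseteq> \<tau> y" if "a \<in> F" "a \<sqsubseteq> y" for a y
  proof -
    have "a \<leadsto> \<tau> y = \<tau> (a \<leadsto> y)"
      using U3_r[of a y] \<open>a \<in> F\<close> by (simp add: imp_r_eq_oplus F_def)
    also have "\<dots> = 1"
      using \<open>a \<sqsubseteq> y\<close> by (simp add: BE_le_iff_imp_r one)
    finally show ?thesis
      by (simp add: BE_le_iff_imp_r)
  qed
  have mono: "\<tau> x \<sqsubseteq> \<tau> y" if "x \<sqsubseteq> y" for x y
    using greatest F_tau BE_le_trans U1 that by blast
  show ?thesis
  proof
    show "\<tau> (x \<sqinter> y) = \<tau> x \<sqinter> \<tau> y" for x y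
    proof (rule BE_le_antisym)
      show "\<tau> (x \<sqinter> y) \<sqsubseteq> \<tau> x \<sqinter> \<tau> y"
        by (intro BE_meet_greatest mono BE_meet_lower1 BE_meet_lower2)
      have "\<tau> x \<sqinter> \<tau> y \<sqsubseteq> x \<sqinter> y"
        using BE_meet_greatest BE_meet_lower1 BE_meet_lower2 BE_le_trans U1 by meson
      then show "\<tau> x \<sqinter> \<tau> y \<sqsubseteq> \<tau> (x \<sqinter> y)"
        by (intro greatest F_meet F_tau)
    qed
    show "\<tau> (\<tau> x \<odot> \<tau> y) = \<tau> x \<odot> \<tau> y" for x y
      using F_odot[OF F_tau F_tau] by (simp add: F_def)
    show "\<tau> (x \<odot> x) = \<tau> x \<odot> \<tau> x" for x
      by (simp add: odot_eq_oplus U5_l)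
  qed (simp_all add: U1 U6 neg_l neg_r)
qed

end
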